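(* Let $0<\alpha\le 1$. If $f\in C^{\alpha}[0,1]$, then there exists $A\subseteq[0,1]$ such that $f|_A$ is monotone and $\dim_H A\ge\alpha$.
   Context: For $0<\alpha<1$, $C^{\alpha}[0,1]$ is the set of functions $f:[0,1]\to\mathbb R$ with $\sup\{|f(x)-f(y)|/|x-y|^{\alpha}: x\ne y,\ x,y\in[0,1]\}<\infty$. $C^{1}[0,1]$ is the set of functions $f:[0,1]\to\mathbb R$ that are differentiable with continuous derivative on $[0,1]$. Monotone means (not necessarily strictly) monotone increasing or monotone decreasing. $\dim_H$ denotes Hausdorff dimension. *)

theory Defs
  imports "HOL-Analysis.Analysis"
begin

text \<open>
  A function on \<open>[0,1]\<close> is represented by a total function \<open>real \<Rightarrow> real\<close>; none of the definitions
  below depends on its values outside \<open>[0,1]\<close>.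
\<close>

definition holder_space :: "real \<Rightarrow> (real \<Rightarrow> real) set" where
  "holder_space \<alpha> = {f. bdd_above
     {\<bar>f x - f y\<bar> / \<bar>x - y\<bar> powr \<alpha> | x y. x \<in> {0..1} \<and> y \<in> {0..1} \<and> x \<noteq> y}}"

text \<open>
  The derivative is taken within \<open>[0,1]\<close>, hence one-sided at the endpoints. The library's
  \<open>C1_differentiable_on\<close> would require two-sided derivatives there.
\<close>

definition C1_space :: "(real \<Rightarrow> real) set" where
  "C1_space = {f. \<exists>f'. (\<forall>x\<in>{0..1}. (f has_real_derivative f' x) (at x within {0..1}))
     \<and> continuous_on {0..1} f'}"

text \<open>
  Exponent \<open>1\<close> denotes continuously differentiable functions, not Lipschitz ones.
  Only exponents in \<open>(0,1]\<close> are meaningful.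
\<close>

definition C_space :: "real \<Rightarrow> (real \<Rightarrow> real) set" where
  "C_space \<alpha> = (if \<alpha> = 1 then C1_space else holder_space \<alpha>)"

text \<open>
  The \<open>s\<close>-th power of the diameter, with the usual conventions at \<open>s = 0\<close>: it is \<open>1\<close> for every
  nonempty set, so that the \<open>0\<close>-dimensional measure counts points, while \<open>0 powr 0 = 0\<close> in the
  library. Only used for bounded sets, since \<open>diameter\<close> is unspecified on unbounded ones.
\<close>

definition diameter_powr :: "real \<Rightarrow> 'a::metric_space set \<Rightarrow> ennreal" where
  "diameter_powr s U =
     (if U = {} then 0 else if s = 0 then 1 else ennreal (diameter U powr s))"

text \<open>
  Covers are indexed by \<open>nat\<close>; finite covers are included, as the sets may be empty.
\<close>

definition hausdorff_premeasure :: "real \<Rightarrow> real \<Rightarrow> 'a::metric_space set \<Rightarrow> ennreal" where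
  "hausdorff_premeasure s \<delta> A =
     (INF U \<in> {U :: nat \<Rightarrow> 'a set. A \<subseteq> (\<Union>i. U i) \<and> (\<forall>i. bounded (U i) \<and> diameter (U i) \<le> \<delta>)}.
        \<Sum>i. diameter_powr s (U i))"

definition hausdorff_measure :: "real \<Rightarrow> 'a::metric_space set \<Rightarrow> ennreal" where
  "hausdorff_measure s A = (SUP \<delta> \<in> {0<..}. hausdorff_premeasure s \<delta> A)"

definition hausdorff_dim :: "'a::metric_space set \<Rightarrow> ennreal" where
  "hausdorff_dim A = Inf {ennreal s | s. 0 \<le> s \<and> hausdorff_measure s A = 0}"

end

theory Submission
  imports Defs
begin

text \<open>
  A Hoelder continuous map of exponent \<open>\<alpha>\<close> sends a set of diameter \<open>d\<close> to a set of diameter at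
  most \<open>C * d powr \<alpha>\<close>. A set whose image contains a nondegenerate interval therefore has dimension
  at least \<open>\<alpha>\<close> (\<open>hausdorff_dim_ge_if_holder_image_contains_interval\<close>), and it suffices to find such a
  set on which \<open>f\<close> is monotone.

  If \<open>f a < f b\<close> with \<open>a < b\<close>, such a set consists of the last passage times, the points
  of \<open>[a,b]\<close> after which all values of \<open>f\<close> are larger: \<open>f\<close> is increasing on them by their very
  definition. Every level between \<open>f a\<close> and \<open>f b\<close> has one, namely the last point where \<open>f\<close> takes
  this value: after it \<open>f\<close> never returns to the level and ends at \<open>f b\<close>, so it stays above
  (\<open>image_last_passage_times\<close>). If \<open>f a > f b\<close>, apply this to \<open>- f\<close>. A constant \<open>f\<close> is
  monotone on all of \<open>[0,1]\<close>, and the identity, being Hoelder there, shows that this set is large enough.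

  Exponent \<open>1\<close> fits into the same argument, because a continuously differentiable function has a
  bounded derivative on \<open>[0,1]\<close> and is therefore Lipschitz.
\<close>

section \<open>Hoelder images and Hausdorff dimension\<close>

text \<open>
  Every cover of \<open>A\<close> induces a cover of the interval: the image of the part of \<open>A\<close> in a covering
  set lies within \<open>C * diameter powr \<alpha>\<close> of the image of any one of its points. So countable
  subadditivity of Lebesgue measure bounds the sum over the cover from below. Passing from \<open>\<alpha>\<close> to \<open>s \<le> \<alpha>\<close> enlarges the powers because the
  diameters are at most \<open>1\<close>.
\<close>

lemma hausdorff_premeasure_ge_if_holder_image_contains_interval:
  fixes A :: "'a::metric_space set" and g :: "'a \<Rightarrow> real"
  assumes holder: "\<And>x y. x \<in> A \<Longrightarrow> y \<in> A \<Longrightarrow> \<bar>g x - g y\<bar> \<le> C * dist x y powr \<alpha>"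
    and "0 < C" and "0 \<le> s" and "s \<le> \<alpha>" and "0 < \<alpha>"
    and image: "{c..d} \<subseteq> g ` A"
  shows "ennreal (d - c) / ennreal (2 * C) \<le> hausdorff_premeasure s 1 A"
proof -
  have cover_sum: "ennreal (d - c) \<le> ennreal (2 * C) * (\<Sum>i. diameter_powr s (U i))"
    if cover: "A \<subseteq> (\<Union>i. U i)" and bdd: "\<And>i. bounded (U i)" and small: "\<And>i. diameter (U i) \<le> 1"
    for U :: "nat \<Rightarrow> 'a set"
  proof -
    define r where "r i = C * diameter (U i) powr \<alpha>" for i
    define p where "p i = (SOME x. x \<in> A \<inter> U i)" for i
    define V where "V i = (if A \<inter> U i = {} then {} else {g (p i) - r i..g (p i) + r i})" for i
    have r_nonneg: "0 \<le> r i" for i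
      using \<open>0 < C\<close> by (simp add: r_def)
    have V_covers: "g x \<in> V i" if "x \<in> A" "x \<in> U i" for x i
    proof -
      have "p i \<in> A \<inter> U i"
        unfolding p_def by (rule someI[of _ x]) (use that in simp)
      then have "\<bar>g x - g (p i)\<bar> \<le> C * dist x (p i) powr \<alpha>"
        using holder that by simp
      also have "\<dots> \<le> r i"
        unfolding r_def
        using \<open>p i \<in> A \<inter> U i\<close> that \<open>0 < C\<close> \<open>0 < \<alpha>\<close> diameter_bounded_bound[OF bdd]
        by (intro mult_left_mono powr_mono2) auto
      finally show ?thesis
        using that by (auto simp: V_def abs_le_iff)
    qed
    have V_measure: "emeasure lborel (V i) \<le> ennreal (2 * C) * diameter_powr s (U i)" for i
    proof (cases "A \<inter> U i = {}")
      case False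
      have diam_nonneg: "0 \<le> diameter (U i)"
        by (rule diameter_ge_0[OF bdd])
      have "diameter (U i) powr \<alpha> \<le> diameter (U i) powr s"
        using powr_mono'[OF \<open>s \<le> \<alpha>\<close> diam_nonneg small] .
      \<comment> \<open>For \<open>s = 0\<close> the \<open>s\<close>-th power of a diameter \<open>0\<close> counts as \<open>1\<close>, unlike \<open>0 powr 0\<close>.\<close>
      moreover have "diameter (U i) powr \<alpha> \<le> 1"
        using powr_mono2[of \<alpha> "diameter (U i)" 1] diam_nonneg small \<open>0 < \<alpha>\<close> by simp
      ultimately have "ennreal (diameter (U i) powr \<alpha>) \<le> diameter_powr s (U i)"
        using False by (auto simp: diameter_powr_def ennreal_leI simp flip: ennreal_1)
      moreover have "emeasure lborel (V i) = ennreal (2 * C) * ennreal (diameter (U i) powr \<alpha>)"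
        using False r_nonneg[of i] \<open>0 < C\<close> by (simp add: V_def r_def flip: ennreal_mult)
      ultimately show ?thesis
        by (simp add: mult_left_mono)
    qed (simp add: V_def)
    have "ennreal (d - c) \<le> emeasure lborel {c..d}"
      by (cases "c \<le> d") (auto simp: ennreal_neg)
    also have "\<dots> \<le> emeasure lborel (\<Union>i. V i)"
    proof (rule emeasure_mono)
      show "{c..d} \<subseteq> (\<Union>i. V i)"
        using image cover V_covers by fastforce
    qed (auto simp: V_def)
    also have "\<dots> \<le> (\<Sum>i. emeasure lborel (V i))"
      by (rule emeasure_subadditive_countably) (auto simp: V_def)
    also have "\<dots> \<le> (\<Sum>i. ennreal (2 * C) * diameter_powr s (U i))"
      by (intro suminf_le V_measure) auto
    finally show ?thesis
      by simp
  qed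
  show ?thesis
    unfolding hausdorff_premeasure_def
  proof (rule INF_greatest, clarsimp)
    fix U :: "nat \<Rightarrow> 'a set"
    assume "A \<subseteq> (\<Union>i. U i)" and "\<forall>i. bounded (U i) \<and> diameter (U i) \<le> 1"
    then show "ennreal (d - c) / ennreal (2 * C) \<le> (\<Sum>i. diameter_powr s (U i))"
      using cover_sum[of U] \<open>0 < C\<close>
      by (intro divide_le_posI_ennreal) (auto simp: mult.commute)
  qed
qed

lemma hausdorff_dim_ge_if_holder_image_contains_interval:
  fixes A :: "'a::metric_space set" and g :: "'a \<Rightarrow> real"
  assumes holder: "\<And>x y. x \<in> A \<Longrightarrow> y \<in> A \<Longrightarrow> \<bar>g x - g y\<bar> \<le> C * dist x y powr \<alpha>"
    and "0 < C" and "0 < \<alpha>" and "c < d" and "{c..d} \<subseteq> g ` A"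
  shows "ennreal \<alpha> \<le> hausdorff_dim A"
  unfolding hausdorff_dim_def
proof (rule Inf_greatest, clarify)
  fix s :: real
  assume "0 \<le> s" and null: "hausdorff_measure s A = 0"
  show "ennreal \<alpha> \<le> ennreal s"
  proof (rule ccontr)
    assume "\<not> ennreal \<alpha> \<le> ennreal s"
    then have "s \<le> \<alpha>"
      using ennreal_leI[of \<alpha> s] by linarith
    have "hausdorff_premeasure s 1 A \<le> hausdorff_measure s A"
      unfolding hausdorff_measure_def by (rule SUP_upper) simp
    then have "hausdorff_premeasure s 1 A = 0"
      using null by simp
    then have "ennreal (d - c) / ennreal (2 * C) \<le> 0"
      using hausdorff_premeasure_ge_if_holder_image_contains_interval
        [OF holder \<open>0 < C\<close> \<open>0 \<le> s\<close> \<open>s \<le> \<alpha>\<close> \<open>0 < \<alpha>\<close> \<open>{c..d} \<subseteq> g ` A\<close>]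
      by simp
    then show False
      using \<open>c < d\<close> by (auto simp: ennreal_divide_eq_0_iff)
  qed
qed

section \<open>Last passage times\<close>

definition last_passage_times :: "(real \<Rightarrow> real) \<Rightarrow> real \<Rightarrow> real \<Rightarrow> real set" where
  "last_passage_times f a b = {x \<in> {a..b}. \<forall>t \<in> {x<..b}. f x < f t}"

lemma mono_on_last_passage_times: "mono_on (last_passage_times f a b) f"
proof (rule mono_onI)
  fix x y
  assume "x \<in> last_passage_times f a b" "y \<in> last_passage_times f a b" "x \<le> y"
  then show "f x \<le> f y"
    by (cases "x = y") (auto simp: last_passage_times_def intro: less_imp_le)
qed

text \<open>
  Each level is attained, and for the last time at a point after which the intermediate value
  theorem keeps \<open>f\<close> above this level.
\<close>

lemma image_last_passage_times:
  fixes f :: "real \<Rightarrow> real"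
  assumes "continuous_on {a..b} f" and "a \<le> b"
  shows "{f a..f b} \<subseteq> f ` last_passage_times f a b"
proof
  fix y
  assume y: "y \<in> {f a..f b}"
  define S where "S = {x \<in> {a..b}. f x = y}"
  have "closed S"
    unfolding S_def
    using continuous_closed_preimage_constant[OF assms(1), of y] by simp
  then have "compact S"
    unfolding compact_eq_bounded_closed
    using bounded_subset[OF bounded_closed_interval[of a b], of S] S_def by blast
  moreover have "S \<noteq> {}"
    using IVT'[of f a y b] assms y by (auto simp: S_def)
  ultimately obtain x where "x \<in> S" and last: "\<And>t. t \<in> S \<Longrightarrow> t \<le> x"
    using compact_attains_sup[of S] by blast
  have "f x < f t" if t: "t \<in> {x<..b}" for t
  proof (rule ccontr)
    assume "\<not> f x < f t"
    then have "f t \<le> y" and "a \<le> t"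
      using \<open>x \<in> S\<close> t by (auto simp: S_def)
    moreover have "continuous_on {t..b} f"
      using \<open>a \<le> t\<close> by (intro continuous_on_subset[OF assms(1)]) auto
    ultimately obtain u where "t \<le> u" "u \<le> b" "f u = y"
      using IVT'[of f t y b] y t by auto
    then show False
      using last[of u] t \<open>a \<le> t\<close> by (auto simp: S_def)
  qed
  then show "y \<in> f ` last_passage_times f a b"
    using \<open>x \<in> S\<close> by (auto simp: S_def last_passage_times_def)
qed

section \<open>Hoelder bounds for the function spaces\<close>

lemma holder_bound_if_C_space:
  assumes "f \<in> C_space \<alpha>"
  obtains C where "0 < C"
    and "\<And>x y. x \<in> {0..1} \<Longrightarrow> y \<in> {0..1} \<Longrightarrow> \<bar>f x - f y\<bar> \<le> C * dist x y powr \<alpha>"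
proof (cases "\<alpha> = 1")
  case True
  then obtain f' where
    deriv: "\<And>x. x \<in> {0..1} \<Longrightarrow> (f has_real_derivative f' x) (at x within {0..1})"
    and cont: "continuous_on {0..1} f'"
    using assms by (auto simp: C_space_def C1_space_def simp del: atLeastAtMost_iff)
  have "bounded (f' ` {0..1})"
    by (intro compact_imp_bounded compact_continuous_image cont) simp
  then obtain B where B: "\<And>x. x \<in> {0..1} \<Longrightarrow> \<bar>f' x\<bar> \<le> B"
    by (auto simp: bounded_iff simp del: atLeastAtMost_iff)
  show ?thesis
  proof (rule that)
    show "0 < B + 1"
      using B[of 0] by simp
    show "\<bar>f x - f y\<bar> \<le> (B + 1) * dist x y powr \<alpha>" if "x \<in> {0..1}" "y \<in> {0..1}" for x y
      using field_differentiable_bound[of "{0..1}" f f' "B + 1" x y] deriv order_trans[OF B] that True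
      by (auto simp: dist_real_def)
  qed
next
  case False
  then have "bdd_above {\<bar>f x - f y\<bar> / \<bar>x - y\<bar> powr \<alpha> | x y. x \<in> {0..1} \<and> y \<in> {0..1} \<and> x \<noteq> y}"
    using assms by (simp add: C_space_def holder_space_def)
  then obtain M where
    M: "\<And>x y. x \<in> {0..1} \<Longrightarrow> y \<in> {0..1} \<Longrightarrow> x \<noteq> y \<Longrightarrow> \<bar>f x - f y\<bar> / \<bar>x - y\<bar> powr \<alpha> \<le> M"
    unfolding bdd_above_def by blast
  show ?thesis
  proof (rule that)
    show "0 < M + 1"
      using M[of 0 1] by simp
    show "\<bar>f x - f y\<bar> \<le> (M + 1) * dist x y powr \<alpha>" if "x \<in> {0..1}" "y \<in> {0..1}" for x y
    proof (cases "x = y")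
      case False
      then have "\<bar>f x - f y\<bar> / \<bar>x - y\<bar> powr \<alpha> \<le> M + 1"
        using M[of x y] that by simp
      then show ?thesis
        using False by (simp add: dist_real_def pos_divide_le_eq)
    qed simp
  qed
qed

lemma continuous_on_if_holder_bound:
  fixes f :: "'a::metric_space \<Rightarrow> 'b::metric_space"
  assumes "\<And>x y. x \<in> S \<Longrightarrow> y \<in> S \<Longrightarrow> dist (f x) (f y) \<le> C * dist x y powr \<alpha>" and "0 < \<alpha>"
  shows "continuous_on S f"
  unfolding continuous_on_def
proof
  fix x
  assume "x \<in> S"
  have "((\<lambda>y. dist y x powr \<alpha>) \<longlongrightarrow> 0) (at x within S)"
    by (rule tendsto_zero_powrI[where b = \<alpha>])
      (use \<open>0 < \<alpha>\<close> in \<open>auto intro!: tendsto_eq_intros\<close>)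
  then have "((\<lambda>y. C * dist y x powr \<alpha>) \<longlongrightarrow> 0) (at x within S)"
    by (rule tendsto_mult_right_zero)
  moreover have "\<forall>\<^sub>F y in at x within S. norm (dist (f y) (f x)) \<le> C * dist y x powr \<alpha>"
    using assms(1) \<open>x \<in> S\<close> by (auto simp: eventually_at_filter)
  ultimately have "((\<lambda>y. dist (f y) (f x)) \<longlongrightarrow> 0) (at x within S)"
    by (rule Lim_null_comparison[rotated])
  then show "(f \<longlongrightarrow> f x) (at x within S)"
    by (rule iffD2[OF tendsto_dist_iff])
qed

section \<open>Monotone restrictions\<close>

lemma mono_on_large_subset_if_rise:
  fixes f :: "real \<Rightarrow> real"
  assumes holder: "\<And>x y. x \<in> {a..b} \<Longrightarrow> y \<in> {a..b} \<Longrightarrow> \<bar>f x - f y\<bar> \<le> C * dist x y powr \<alpha>"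
    and "0 < C" and "0 < \<alpha>" and "a \<le> b" and "f a < f b"
  shows "\<exists>A \<subseteq> {a..b}. mono_on A f \<and> ennreal \<alpha> \<le> hausdorff_dim A"
proof (intro exI conjI)
  show sub: "last_passage_times f a b \<subseteq> {a..b}"
    by (auto simp: last_passage_times_def)
  have "continuous_on {a..b} f"
    by (rule continuous_on_if_holder_bound[of _ f C \<alpha>])
      (use holder \<open>0 < \<alpha>\<close> in \<open>auto simp: dist_real_def\<close>)
  then show "ennreal \<alpha> \<le> hausdorff_dim (last_passage_times f a b)"
    using hausdorff_dim_ge_if_holder_image_contains_interval
      [of "last_passage_times f a b" f C \<alpha> "f a" "f b"]
      image_last_passage_times holder sub assms(2-5) by blast
qed (rule mono_on_last_passage_times)

theorem theorem3:
  fixes \<alpha> :: real and f :: "real \<Rightarrow> real"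
  assumes "0 < \<alpha>" and "\<alpha> \<le> 1"
    and "f \<in> C_space \<alpha>"
  shows "\<exists>A. A \<subseteq> {0..1} \<and> (mono_on A f \<or> antimono_on A f) \<and> hausdorff_dim A \<ge> ennreal \<alpha>"
proof -
  obtain C where "0 < C"
    and holder: "\<And>x y. x \<in> {0..1} \<Longrightarrow> y \<in> {0..1} \<Longrightarrow> \<bar>f x - f y\<bar> \<le> C * dist x y powr \<alpha>"
    using holder_bound_if_C_space[OF assms(3)] by blast
  consider (rise) a b where "0 \<le> a" "a \<le> b" "b \<le> 1" "f a < f b"
    | (fall) a b where "0 \<le> a" "a \<le> b" "b \<le> 1" "f b < f a"
    | (const) "\<And>x y. x \<in> {0..1} \<Longrightarrow> y \<in> {0..1} \<Longrightarrow> x \<le> y \<Longrightarrow> f x = f y"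
    by (metis atLeastAtMost_iff linorder_neqE)
  then show ?thesis
  proof cases
    case rise
    then obtain A where "A \<subseteq> {a..b}" "mono_on A f" "ennreal \<alpha> \<le> hausdorff_dim A"
      using mono_on_large_subset_if_rise[of a b f C \<alpha>] holder \<open>0 < C\<close> \<open>0 < \<alpha>\<close> by auto
    then show ?thesis
      using rise by (intro exI[of _ A]) auto
  next
    case fall
    then obtain A where "A \<subseteq> {a..b}" "mono_on A (\<lambda>x. - f x)" "ennreal \<alpha> \<le> hausdorff_dim A"
      using mono_on_large_subset_if_rise[of a b "\<lambda>x. - f x" C \<alpha>] holder \<open>0 < C\<close> \<open>0 < \<alpha>\<close>
      by (auto simp: abs_minus_commute)
    then show ?thesis
      using fall by (intro exI[of _ A]) (auto simp: monotone_on_def)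
  next
    case const
    have id_holder: "\<bar>x - y\<bar> \<le> 1 * dist x y powr \<alpha>" if "x \<in> {0..1}" "y \<in> {0..1}" for x y :: real
      using powr_mono'[of \<alpha> 1 "\<bar>x - y\<bar>"] that \<open>\<alpha> \<le> 1\<close>
      by (auto simp: dist_real_def abs_le_iff)
    have "ennreal \<alpha> \<le> hausdorff_dim {0..1::real}"
      by (rule hausdorff_dim_ge_if_holder_image_contains_interval
          [where g = "\<lambda>x. x" and C = 1 and c = 0 and d = 1])
        (use id_holder \<open>0 < \<alpha>\<close> in auto)
    moreover have "mono_on {0..1} f"
      using const by (intro mono_onI) (metis order_refl)
    ultimately show ?thesis
      by blast
  qed
qed

end
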